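(* Let $n\ge1$ and $m>2^n$ be integers. Kronecker holds a list of $m$ vectors $v_1,\ldots,v_m\in\{0,1\}^n$; Cantor adaptively queries entries ``bit $j$ of vector $i$'', and his goal is to determine whether $\{v_1,\ldots,v_m\}\supseteq\{0,1\}^n$. Suppose Kronecker answers according to the ``0 first'' strategy (defined in the context). Then for every (adaptive) strategy of Cantor, Cantor must make all $mn$ queries in order to determine whether the list contains every vector of $\{0,1\}^n$; that is, after any fewer than $mn$ queries, the answers given so far are consistent both with a list containing all of $\{0,1\}^n$ and with a list not containing all of $\{0,1\}^n$.
   Context: The state of the game is an $m\times n$ matrix $L$ with entries in $\{0,1,\star\}$, where $L(i,j)=\star$ means bit $j$ of $v_i$ has not been queried yet and otherwise $L(i,j)$ is Kronecker's answer; initially all entries are $\star$, and each query is to an entry currently equal to $\star$. Row $i$ of $L$ is denoted $L(i)$. A set $S$ of $2^n$ rows of $L$ is useful if, after replacing each $\star$ in the rows of $S$ by $0$ or $1$ suitably, the rows of $S$ are exactly the $2^n$ distinct vectors of $\{0,1\}^n$. $L$ is unblocked if it has a useful set of rows, and blocked otherwise. The ``0 first'' strategy of Kronecker: when Cantor queries entry $(i,j)$, Kronecker answers $1$ if setting $L(i,j)$ to $0$ would make $L$ blocked, and answers $0$ otherwise. *)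

theory Defs
  imports Main "HOL-Library.FuncSet"
begin

text \<open>
  Bits are Booleans (\<^const>\<open>False\<close> is 0, \<^const>\<open>True\<close> is 1), indices start at 0, and an unqueried
  entry (a star) is \<^const>\<open>None\<close>. Of a board only the entries below \<open>m\<close> and \<open>n\<close> are meaningful.
\<close>

type_synonym board = "nat \<Rightarrow> nat \<Rightarrow> bool option"

definition cube :: "nat \<Rightarrow> (nat \<Rightarrow> bool) set" where
  "cube n = {..<n} \<rightarrow>\<^sub>E UNIV"

definition completes_row :: "nat \<Rightarrow> (nat \<Rightarrow> bool option) \<Rightarrow> (nat \<Rightarrow> bool) \<Rightarrow> bool" where
  "completes_row n r x \<longleftrightarrow> x \<in> cube n \<and> (\<forall>j<n. \<forall>b. r j = Some b \<longrightarrow> x j = b)"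

definition useful :: "nat \<Rightarrow> nat \<Rightarrow> board \<Rightarrow> nat set \<Rightarrow> bool" where
  "useful m n L S \<longleftrightarrow> S \<subseteq> {..<m} \<and> card S = 2 ^ n \<and>
     (\<exists>f. (\<forall>i\<in>S. completes_row n (L i) (f i)) \<and> bij_betw f S (cube n))"

definition unblocked :: "nat \<Rightarrow> nat \<Rightarrow> board \<Rightarrow> bool" where
  "unblocked m n L \<longleftrightarrow> (\<exists>S. useful m n L S)"

abbreviation blocked :: "nat \<Rightarrow> nat \<Rightarrow> board \<Rightarrow> bool" where
  "blocked m n L \<equiv> \<not> unblocked m n L"

definition set_entry :: "board \<Rightarrow> nat \<Rightarrow> nat \<Rightarrow> bool \<Rightarrow> board" where
  "set_entry L i j b = L(i := (L i)(j := Some b))"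

definition zero_first :: "nat \<Rightarrow> nat \<Rightarrow> board \<Rightarrow> nat \<Rightarrow> nat \<Rightarrow> bool" where
  "zero_first m n L i j = (if blocked m n (set_entry L i j False) then True else False)"

text \<open>
  A history lists the queries made so far, in chronological order, together with their answers.
  A strategy of Cantor maps the history to his next query, or to \<^const>\<open>None\<close> if he stops.
\<close>

type_synonym history = "(nat \<times> nat \<times> bool) list"
type_synonym strategy = "history \<Rightarrow> (nat \<times> nat) option"

text \<open>
  \<open>play m n \<sigma> h L\<close>: with Cantor following \<open>\<sigma>\<close> and Kronecker answering ``0 first'', the game passes
  through the history \<open>h\<close>, with \<open>L\<close> the board at that moment. Only queries to an entry that is
  currently a star are admitted.
\<close>

inductive play :: "nat \<Rightarrow> nat \<Rightarrow> strategy \<Rightarrow> history \<Rightarrow> board \<Rightarrow> bool"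
  for m n :: nat and \<sigma> :: strategy where
  start: "play m n \<sigma> [] (\<lambda>i j. None)"
| query: "\<lbrakk> play m n \<sigma> h L; \<sigma> h = Some (i, j); i < m; j < n; L i j = None;
            b = zero_first m n L i j \<rbrakk>
          \<Longrightarrow> play m n \<sigma> (h @ [(i, j, b)]) (set_entry L i j b)"

definition consistent_list :: "nat \<Rightarrow> nat \<Rightarrow> history \<Rightarrow> (nat \<Rightarrow> nat \<Rightarrow> bool) \<Rightarrow> bool" where
  "consistent_list m n h v \<longleftrightarrow>
     (\<forall>i<m. v i \<in> cube n) \<and> (\<forall>(i, j, b) \<in> set h. v i j = b)"

end

theory Submission imports Defs begin

text \<open>
  The game keeps two invariants: the board is unblocked, and turning any answered 1 into a 0 blocks
  it. Suppose every completion of a board with a star at \<open>(i, j)\<close> covers the cube. Fill all stars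
  with 0, except that \<open>(i, j)\<close> may be 0 or 1: since both choices cover, the rows other than \<open>i\<close>
  already cover. Hence row \<open>i\<close> has no answered 1, for that 1 could be turned into a 0. Some other
  row \<open>k\<close> is the unit vector \<open>e\<^sub>j\<close>; but its 1 could be turned into a 0 too, with row \<open>i\<close> taking
  over as \<open>e\<^sub>j\<close>. This contradicts the second invariant.
\<close>

definition completion :: "nat \<Rightarrow> nat \<Rightarrow> board \<Rightarrow> (nat \<Rightarrow> nat \<Rightarrow> bool) \<Rightarrow> bool" where
  "completion m n L v \<longleftrightarrow> (\<forall>i<m. completes_row n (L i) (v i))"

text \<open>The completion with the fewest ones: a 1 in it can only come from an answered 1, so
  \<open>ones_forced\<close> applies to every 1 that it contains.\<close>

definition zero_fill :: "nat \<Rightarrow> board \<Rightarrow> nat \<Rightarrow> nat \<Rightarrow> bool" where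
  "zero_fill n L i = (\<lambda>j\<in>{..<n}. L i j = Some True)"

definition ones_forced :: "nat \<Rightarrow> nat \<Rightarrow> board \<Rightarrow> bool" where
  "ones_forced m n L \<longleftrightarrow>
     (\<forall>i<m. \<forall>j<n. L i j = Some True \<longrightarrow> blocked m n (set_entry L i j False))"

lemma finite_cube: "finite (cube n)"
  unfolding cube_def by (rule finite_PiE) auto

lemma card_cube: "card (cube n) = 2 ^ n"
  unfolding cube_def by (subst card_PiE) auto

lemma restrict_in_cube: "(\<lambda>j\<in>{..<n}. P j) \<in> cube n"
  unfolding cube_def by auto

lemma completion_zero_fill: "completion m n L (zero_fill n L)"
  by (simp add: completion_def completes_row_def zero_fill_def restrict_in_cube)

text \<open>Rows outside a useful set can be completed arbitrarily, here by
  \<open>zero_fill\<close>; conversely, choosing one row for each vector of the cube in a covering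
  completion gives a useful set. From here on, arguments are about covering completions.\<close>

lemma unblocked_iff:
  "unblocked m n L \<longleftrightarrow> (\<exists>v. completion m n L v \<and> cube n \<subseteq> v ` {..<m})"
proof
  assume "unblocked m n L"
  then obtain S f where S: "S \<subseteq> {..<m}" and f: "\<And>i. i \<in> S \<Longrightarrow> completes_row n (L i) (f i)"
    and bij: "bij_betw f S (cube n)"
    by (auto simp: unblocked_def useful_def)
  define v where "v = (\<lambda>i. if i \<in> S then f i else zero_fill n L i)"
  have "completion m n L v"
    using f completion_zero_fill[of m n L] by (auto simp: completion_def v_def)
  moreover have "v ` S = cube n"
    using bij by (auto simp: v_def bij_betw_def)
  ultimately show "\<exists>v. completion m n L v \<and> cube n \<subseteq> v ` {..<m}"
    using S by (metis image_mono)
next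
  assume "\<exists>v. completion m n L v \<and> cube n \<subseteq> v ` {..<m}"
  then obtain v where v: "completion m n L v" and cov: "cube n \<subseteq> v ` {..<m}" by blast
  obtain S where S: "S \<subseteq> {..<m}" "inj_on v S" "cube n = v ` S"
    using cov by (auto simp: subset_image_inj)
  have "bij_betw v S (cube n)"
    using S by (simp add: bij_betw_def)
  moreover have "card S = 2 ^ n"
    using calculation bij_betw_same_card card_cube by metis
  ultimately show "unblocked m n L"
    using S(1) v unfolding unblocked_def useful_def completion_def by blast
qed

text \<open>A board with fewer answers has more completions, so a covering one survives.\<close>

lemma unblocked_mono:
  assumes "unblocked m n L'" and "\<And>i j b. L i j = Some b \<Longrightarrow> L' i j = Some b"
  shows "unblocked m n L"
proof -
  obtain v where "completion m n L' v" "cube n \<subseteq> v ` {..<m}"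
    using assms(1) by (auto simp: unblocked_iff)
  moreover have "completion m n L v"
    using calculation(1) assms(2) by (simp add: completion_def completes_row_def)
  ultimately show ?thesis by (auto simp: unblocked_iff)
qed

lemma unblocked_empty:
  assumes "2 ^ n \<le> m"
  shows "unblocked m n (\<lambda>i j. None)"
proof -
  obtain f where f: "bij_betw f {..<2 ^ n :: nat} (cube n)"
    using ex_bij_betw_nat_finite[OF finite_cube[of n]]
    by (auto simp: card_cube lessThan_atLeast0)
  have "useful m n (\<lambda>i j. None) {..<2 ^ n}"
    unfolding useful_def completes_row_def using f assms
    by (intro conjI exI[of _ f]) (auto simp: bij_betw_def)
  then show ?thesis by (auto simp: unblocked_def)
qed

text \<open>Take a covering completion \<open>v\<close> of \<open>L\<close>. It still completes the
  board once the entry is set to \<open>v i j\<close>; so if 0 blocks, then \<open>v i j\<close> is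
  1 and the answer 1 is safe.\<close>

lemma unblocked_zero_first:
  assumes "unblocked m n L" and "L i j = None"
  shows "unblocked m n (set_entry L i j (zero_first m n L i j))"
proof (cases "unblocked m n (set_entry L i j False)")
  case True
  then show ?thesis by (simp add: zero_first_def)
next
  case False
  obtain v where v: "completion m n L v" "cube n \<subseteq> v ` {..<m}"
    using assms by (auto simp: unblocked_iff)
  have "completion m n (set_entry L i j (v i j)) v"
    using v(1) by (auto simp: completion_def completes_row_def set_entry_def split: if_splits)
  then have "unblocked m n (set_entry L i j (v i j))"
    using v(2) by (auto simp: unblocked_iff)
  with False show ?thesis by (cases "v i j") (auto simp: zero_first_def)
qed

text \<open>A new 1 is given only when 0 would block. An old 1 stays forced because the new answer
  only adds information, and by \<open>unblocked_mono\<close> a blocked board remains blocked under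
  further answers.\<close>

lemma ones_forced_zero_first:
  assumes "ones_forced m n L" and "L i j = None"
  shows "ones_forced m n (set_entry L i j (zero_first m n L i j))"
  unfolding ones_forced_def
proof (intro allI impI)
  let ?L = "set_entry L i j (zero_first m n L i j)"
  fix k l assume kl: "k < m" "l < n" "?L k l = Some True"
  show "blocked m n (set_entry ?L k l False)"
  proof (cases "k = i \<and> l = j")
    case True
    then have "zero_first m n L i j" and "set_entry ?L k l False = set_entry L i j False"
      using kl by (auto simp: set_entry_def)
    then show ?thesis by (auto simp: zero_first_def split: if_splits)
  next
    case False
    then have "L k l = Some True"
      using kl by (auto simp: set_entry_def split: if_splits)
    then have "blocked m n (set_entry L k l False)"
      using assms kl by (auto simp: ones_forced_def)
    moreover have "set_entry ?L k l False a c = Some b" if "set_entry L k l False a c = Some b"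
      for a c b
      using that assms(2) by (auto simp: set_entry_def split: if_splits)
    ultimately show ?thesis using unblocked_mono by blast
  qed
qed

lemma play_invariants:
  assumes "play m n \<sigma> h L" and "2 ^ n \<le> m"
  shows "unblocked m n L" and "ones_forced m n L"
  using assms
proof (induction rule: play.induct)
  case start
  case 1
  then show ?case by (rule unblocked_empty)
  case 2
  show ?case by (simp add: ones_forced_def)
qed (auto intro: unblocked_zero_first ones_forced_zero_first)

text \<open>Since only stars are queried, no answer is ever overwritten, so the board and the
  history carry the same information.\<close>

lemma play_history:
  assumes "play m n \<sigma> h L"
  shows "(i, j, b) \<in> set h \<longleftrightarrow> L i j = Some b"
    and "(i, j, b) \<in> set h \<Longrightarrow> i < m \<and> j < n"
  using assms
  by (induction arbitrary: i j b rule: play.induct) (auto simp: set_entry_def)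

lemma play_has_star:
  assumes "play m n \<sigma> h L" and "length h < m * n"
  shows "\<exists>i<m. \<exists>j<n. L i j = None"
proof (rule ccontr)
  assume *: "\<not> ?thesis"
  have "{..<m} \<times> {..<n} \<subseteq> (\<lambda>(i, j, b). (i, j)) ` set h"
  proof (rule subrelI)
    fix i j assume "(i, j) \<in> {..<m} \<times> {..<n}"
    then obtain b where "L i j = Some b"
      using * by auto
    then have "(i, j, b) \<in> set h"
      by (simp add: play_history(1)[OF assms(1)])
    then show "(i, j) \<in> (\<lambda>(i, j, b). (i, j)) ` set h" by force
  qed
  then have "card ({..<m} \<times> {..<n}) \<le> card (set h)"
    by (rule surj_card_le[rotated]) simp
  also have "\<dots> \<le> length h" by (rule card_length)
  finally show False using assms(2) by (simp add: card_cartesian_product)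
qed

lemma consistent_list_completion:
  assumes "play m n \<sigma> h L" and "completion m n L v"
  shows "consistent_list m n h v"
  unfolding consistent_list_def
proof (intro conjI allI impI; clarify?)
  fix i assume "i < m"
  then show "v i \<in> cube n"
    using assms(2) by (simp add: completion_def completes_row_def)
next
  fix i j b assume "(i, j, b) \<in> set h"
  then show "v i j = b"
    using play_history[OF assms(1), of i j b] assms(2) by (auto simp: completion_def completes_row_def)
qed

lemma noncovering_completion:
  assumes forced: "ones_forced m n L" and i: "i < m" and j: "j < n" and star: "L i j = None"
  shows "\<exists>v. completion m n L v \<and> \<not> cube n \<subseteq> v ` {..<m}"
proof (rule ccontr)
  assume "\<not> ?thesis"
  then have all: "cube n \<subseteq> v ` {..<m}" if "completion m n L v" for v
    using that by blast
  let ?z = "zero_fill n L"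
  have z: "completion m n L ?z" by (rule completion_zero_fill)
  have others: "\<exists>k<m. k \<noteq> i \<and> ?z k = x" if x: "x \<in> cube n" for x
  proof -
    \<comment> \<open>Both \<open>?z\<close> and \<open>?v\<close> cover the cube and differ only in
      bit \<open>j\<close> of row \<open>i\<close>. Row \<open>i\<close> equals \<open>x\<close> in
      at most one of them, so in the other one \<open>x\<close> occurs in another row.\<close>
    let ?v = "?z(i := (?z i)(j := True))"
    have "completion m n L ?v"
      using z j star by (auto simp: completion_def completes_row_def cube_def PiE_iff extensional_def)
    then obtain k' where k': "k' < m" "?v k' = x" using all x by blast
    obtain k where k: "k < m" "?z k = x" using all[OF z] x by blast
    show ?thesis
    proof (cases "k = i")
      case True
      then have "\<not> x j" using k j star by (auto simp: zero_fill_def)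
      then have "k' \<noteq> i" using k' by auto
      then show ?thesis using k' by auto
    qed (use k in blast)
  qed
  have zero: "L i l \<noteq> Some True" if l: "l < n" for l
  proof
    assume one: "L i l = Some True"
    \<comment> \<open>By \<open>others\<close>, row \<open>i\<close> may be changed freely without
      losing coverage.\<close>
    let ?v = "?z(i := (?z i)(l := False))"
    have "completion m n (set_entry L i l False) ?v"
      using z l by (auto simp: completion_def completes_row_def set_entry_def cube_def PiE_iff extensional_def)
    moreover have "cube n \<subseteq> ?v ` {..<m}"
      using others by (force simp: image_iff)
    ultimately have "unblocked m n (set_entry L i l False)"
      unfolding unblocked_iff by blast
    then show False
      using forced one i l by (auto simp: ones_forced_def)
  qed
  define e where "e = (\<lambda>l\<in>{..<n}. l = j)"
  define u where "u = (\<lambda>l\<in>{..<n}. False)"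
  have cube: "e \<in> cube n" "u \<in> cube n"
    unfolding e_def u_def by (rule restrict_in_cube)+
  obtain k where k: "k < m" "k \<noteq> i" "?z k = e"
    using others cube by blast
  \<comment> \<open>\<open>zero_fill\<close> turns stars into 0, so the 1 of \<open>e\<close> in row
    \<open>k\<close> was answered.\<close>
  have kj: "L k j = Some True"
    using j fun_cong[OF k(3), of j] by (auto simp: zero_fill_def e_def)
  \<comment> \<open>Row \<open>k\<close> gives up its only 1 and becomes the zero vector
    \<open>u\<close>; row \<open>i\<close> can become \<open>e\<close>, as its answers are all 0 and
    its bit \<open>j\<close> is open.\<close>
  let ?v = "?z(k := u, i := e)"
  have "completes_row n (set_entry L k j False a) (?v a)" if a: "a < m" for a
  proof -
    consider "a = i" | "a = k" | "a \<noteq> i" "a \<noteq> k" by blast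
    then show ?thesis
    proof cases
      case 1
      have "b = (l = j)" if "L i l = Some b" "l < n" for l b
        using that zero[of l] star by (cases b) auto
      then show ?thesis
        using 1 k cube by (auto simp: completes_row_def set_entry_def e_def)
    next
      case 2
      \<comment> \<open>Away from \<open>j\<close> the zero filling of row \<open>k\<close> agrees
        with \<open>e\<close>, so an answered 1 there is impossible.\<close>
      have "\<not> b" if "L k l = Some b" "l < n" "l \<noteq> j" for l b
        using that fun_cong[OF k(3), of l] by (auto simp: zero_fill_def e_def)
      then show ?thesis
        using 2 k cube by (auto simp: completes_row_def set_entry_def u_def)
    next
      case 3
      then show ?thesis
        using z a by (auto simp: completion_def set_entry_def)
    qed
  qed
  then have "completion m n (set_entry L k j False) ?v"
    by (simp add: completion_def)
  moreover have "cube n \<subseteq> ?v ` {..<m}"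
  proof
    fix x assume x: "x \<in> cube n"
    \<comment> \<open>Only row \<open>k\<close> among the rows other than \<open>i\<close> has
      changed; if it was the one showing \<open>x\<close>, then \<open>x = e\<close>, which row
      \<open>i\<close> now shows.\<close>
    obtain a where a: "a < m" "a \<noteq> i" "?z a = x" using others x by blast
    show "x \<in> ?v ` {..<m}"
    proof (cases "a = k")
      case True
      then show ?thesis using a k i by (intro image_eqI[of _ _ i]) auto
    next
      case False
      then show ?thesis using a by (intro image_eqI[of _ _ a]) auto
    qed
  qed
  ultimately have "unblocked m n (set_entry L k j False)"
    unfolding unblocked_iff by blast
  then show False
    using forced kj k j by (auto simp: ones_forced_def)
qed

theorem theorem4p5:
  fixes m n :: nat and \<sigma> :: strategy and h :: history and L :: board
  assumes "n \<ge> 1" and "m > 2 ^ n"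
    and "play m n \<sigma> h L"
    and "length h < m * n"
  shows "(\<exists>v. consistent_list m n h v \<and> cube n \<subseteq> v ` {..<m}) \<and>
         (\<exists>v. consistent_list m n h v \<and> \<not> cube n \<subseteq> v ` {..<m})"
proof -
  have inv: "unblocked m n L" "ones_forced m n L"
    using play_invariants[OF assms(3)] assms(2) by auto
  obtain i j where "i < m" "j < n" "L i j = None"
    using play_has_star[OF assms(3,4)] by blast
  then have "\<exists>v. completion m n L v \<and> \<not> cube n \<subseteq> v ` {..<m}"
    by (rule noncovering_completion[OF inv(2)])
  moreover have "\<exists>v. completion m n L v \<and> cube n \<subseteq> v ` {..<m}"
    using inv(1) by (simp add: unblocked_iff)
  ultimately show ?thesis
    using consistent_list_completion[OF assms(3)] by blast
qed

end
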